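(* The function $\phi:[0,\pi]\to\mathbb R$, $$\phi(\theta)=\sum_{j=0}^\infty a_j\,P_{4j+1}(\cos\theta),\qquad a_j=\frac{(j+1)^{-3/2}}{\sum_{\ell=0}^\infty(\ell+1)^{-3/2}},$$ belongs to $\Psi_2$, but $\phi'(\pi/2)$ does not exist.
   Context: $P_n$ denotes the Legendre polynomial of degree $n$, normalized by $P_n(1)=1$. The series defining $\phi$ converges uniformly on $[0,\pi]$ since $|P_n|\le 1$ on $[-1,1]$ and $\sum_j a_j=1$. Let $\mathbb S^2=\{x\in\mathbb R^3:\|x\|=1\}$. A continuous function $\psi:[0,\pi]\to\mathbb R$ belongs to $\Psi_2$ if $\psi(0)=1$ and $\sum_{i,j=1}^N c_ic_j\,\psi(\arccos\langle x_i,x_j\rangle)\ge 0$ for every integer $N\ge 1$, all $x_1,\dots,x_N\in\mathbb S^2$ and all $c_1,\dots,c_N\in\mathbb R$. "$\phi'(\pi/2)$ exists" means that $\phi$ has a finite two-sided derivative at $\pi/2$. *)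

theory Defs
  imports "HOL-Analysis.Analysis" "HOL-Computational_Algebra.Polynomial"
begin

text \<open>Rodrigues' formula. The two lemmas below confirm the degree and the normalization at 1.\<close>

definition legendre :: "nat \<Rightarrow> real poly" where
  "legendre n = smult (1 / (2 ^ n * fact n)) ((pderiv ^^ n) ([:-1, 0, 1:] ^ n))"

lemma degree_legendre: "degree (legendre n) = n"
proof -
  have "degree ((pderiv ^^ k) p) = degree p - k" for k and p :: "real poly"
    by (induction k) (auto simp: degree_pderiv)
  then show ?thesis
    by (simp add: legendre_def degree_power_eq)
qed

lemma poly_legendre_1: "poly (legendre n) 1 = 1"
proof -
  have *: "\<exists>r. (pderiv ^^ k) ([:-1, 1:] ^ n * q) = [:-1, 1:] ^ (n - k) * r \<and>
      poly r 1 * fact (n - k) = fact n * poly q 1"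
    if "k \<le> n" for k and q :: "real poly"
    using that
  proof (induction k)
    case 0
    then show ?case by (intro exI[of _ q]) simp
  next
    case (Suc k)
    then obtain r where r: "(pderiv ^^ k) ([:-1, 1:] ^ n * q) = [:-1, 1:] ^ (n - k) * r"
      "poly r 1 * fact (n - k) = fact n * poly q 1" by auto
    obtain m where m: "n - k = Suc m" "n - Suc k = m"
      using Suc.prems by (metis Suc_diff_Suc Suc_le_lessD)
    have "pderiv ([:-1, 1:] ^ Suc m * r) =
        [:-1, 1:] ^ m * ([:-1, 1:] * pderiv r + smult (of_nat (Suc m)) r)"
    proof -
      define X :: "real poly" where "X = [:-1, 1:]"
      have "pderiv X = 1" by (simp add: X_def pderiv_pCons)
      then have "pderiv (X ^ Suc m * r) = X ^ m * (X * pderiv r + smult (of_nat (Suc m)) r)"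
        by (simp only: pderiv_mult pderiv_power_Suc) (simp add: algebra_simps del: of_nat_Suc)
      then show ?thesis by (simp only: X_def)
    qed
    moreover have "poly ([:-1, 1:] * pderiv r + smult (of_nat (Suc m)) r) 1 * fact m = fact n * poly q 1"
      using r(2) by (simp add: m(1) algebra_simps)
    ultimately show ?case
      using r(1) by (auto simp: m)
  qed
  have "[:-1, 0, 1:] ^ n = [:-1, 1:] ^ n * [:1, 1 :: real:] ^ n"
    by (simp flip: power_mult_distrib)
  with *[of n "[:1, 1:] ^ n"] show ?thesis
    by (auto simp: legendre_def)
qed

definition Psi2 :: "(real \<Rightarrow> real) set" where
  "Psi2 = {\<psi>. continuous_on {0..pi} \<psi> \<and> \<psi> 0 = 1 \<and>
     (\<forall>N\<ge>1. \<forall>(x :: nat \<Rightarrow> real ^ 3) (c :: nat \<Rightarrow> real).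
        (\<forall>i\<in>{1..N}. x i \<in> sphere 0 1) \<longrightarrow>
        (\<Sum>i\<in>{1..N}. \<Sum>j\<in>{1..N}. c i * c j * \<psi> (arccos (x i \<bullet> x j))) \<ge> 0)}"

definition coeff_a :: "nat \<Rightarrow> real" where
  "coeff_a j = real (j + 1) powr (-3/2) / (\<Sum>l. real (l + 1) powr (-3/2))"

text \<open>Functions on \<open>[0, \<pi>]\<close> are total functions on the reals; \<open>Psi2\<close> and the derivative
  at \<open>\<pi>/2\<close>, an interior point, depend only on the values on \<open>[0, \<pi>]\<close>.\<close>

definition phi :: "real \<Rightarrow> real" where
  "phi \<theta> = (\<Sum>j. coeff_a j * poly (legendre (4 * j + 1)) (cos \<theta>))"

end

theory Submission
  imports Defs
begin

text \<open>
Membership in \<^term>\<open>Psi2\<close> comes down to the positive definiteness of each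
\<open>(x, y) \<mapsto> P\<^sub>n(x \<bullet> y)\<close> on the sphere. A point \<open>x\<close> of the sphere is encoded by the complex quadratic polynomial
\<open>Q\<^sub>x(t) = \<zeta> t\<^sup>2 - 2 x\<^sub>3 t - cnj \<zeta>\<close> with \<open>\<zeta> = x\<^sub>1 + \<i> x\<^sub>2\<close>, and
\<open>P\<^sub>n(x \<bullet> y)\<close> is a positive multiple of
\<open>\<Sum>\<^sub>k [t\<^sup>k] Q\<^sub>x\<^sup>n \<cdot> cnj ([t\<^sup>k] Q\<^sub>y\<^sup>n) / (2n choose k)\<close>, a Hermitian inner product of feature vectors
(\<open>legendre_inner_eq_weighted_sum\<close>). This is the rotation invariant inner product on
the binary forms of degree \<open>2n\<close>, and its bilinear version has a reproducing property: pairing a form \<open>f\<close> with the power \<open>(c t + d)\<^sup>2\<^sup>n\<close>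
evaluates \<open>f\<close> at \<open>(c, d)\<close>. The conjugate of \<open>Q\<^sub>y\<close> splits into two linear factors, given by a spinor of \<open>y\<close>,
so polarizing the reproducing property turns the sum into the middle coefficient of the \<open>n\<close>-th power of a quadratic.
By Rodrigues' formula, read as a Taylor coefficient, \<open>P\<^sub>n\<close> is such a middle coefficient too, and the two
agree because a middle coefficient depends only on the linear coefficient and on the product of the other two.
Two points with coefficients \<open>1\<close> and \<open>\<plusminus>1\<close> give \<open>\<bar>P\<^sub>n\<bar> \<le> 1\<close>, hence uniform convergence.

For the derivative, write \<open>u = cos \<theta>\<close> and \<open>d\<^sub>j = P\<^sub>4\<^sub>j\<^sub>+\<^sub>1'(0)\<close>. All \<open>d\<^sub>j\<close> are positive and of order
\<open>\<surd>(j + 1)\<close>, so the formal derivative at \<open>u = 0\<close> is a series of positive terms comparable to the harmonic series.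
Divergence of a formal derivative proves nothing by itself, since the later terms could cancel
the earlier ones away from \<open>0\<close>. Two estimates from Legendre's differential equation exclude this:
with \<open>n = 4j + 1\<close>, the polynomial is at least \<open>d\<^sub>j u / 2\<close> as long as \<open>n u\<close> is small (\<open>legendre_ge_linear\<close>), and
it is at most \<open>2 d\<^sub>j / n\<close> in absolute value on all of \<open>[0, 1/2]\<close> (\<open>abs_legendre_le_deriv_0\<close>).
At \<open>u = 1 / (16 (N + 1))\<close> the terms \<open>j \<le> N\<close> therefore contribute at least a multiple of \<open>u\<close> times the harmonic number
of \<open>N + 1\<close>, while the others contribute at most a constant times
\<open>\<Sum>\<^sub>j\<^sub>>\<^sub>N 1 / j\<^sup>2\<close>, which is only \<open>O(u)\<close>. The difference quotients are thus unbounded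
(\<open>phi_quotient_lower_bound\<close>).
\<close>

section \<open>Legendre polynomials as middle coefficients\<close>

text \<open>Unlike \<open>coeff_linear_poly_power\<close>, valid for every index, so that binomial sums need no range conditions.\<close>
lemma coeff_linear_power_eq:
  fixes a b :: "'a::comm_ring_1"
  shows "coeff ([:b, a:] ^ n) i = of_nat (n choose i) * a ^ i * b ^ (n - i)"
proof (cases "i \<le> n")
  case True
  then show ?thesis by (rule coeff_linear_poly_power)
next
  case False
  then have "degree ([:b, a:] ^ n) < i"
    using degree_power_le[of "[:b, a:]" n] by (auto split: if_splits)
  then show ?thesis using False by (simp add: coeff_eq_0 binomial_eq_0)
qed

text \<open>Of interest is the shape of the right-hand side: \<open>a\<close> and \<open>e\<close> enter only through their product. This is
what allows a quadratic with complex coefficients to represent a real Legendre polynomial.\<close>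

lemma coeff_quadratic_power_middle:
  fixes a b e :: "'a::comm_ring_1"
  shows "coeff ([:e, b, a:] ^ n) n =
    (\<Sum>k\<le>n. of_nat (n choose k) * of_nat ((n - k) choose k) * (a * e) ^ k * b ^ (n - 2 * k))"
proof -
  define q where "q = [:b, a:]"
  have split: "[:e, b, a:] = [:e:] + monom 1 1 * q"
    by (simp add: monom_altdef q_def)
  have summand: "coeff (of_nat (n choose k) * [:e:] ^ k * (monom 1 1 * q) ^ (n - k)) n =
      of_nat (n choose k) * of_nat ((n - k) choose k) * (a * e) ^ k * b ^ (n - 2 * k)"
    if "k \<le> n" for k
  proof -
    have "of_nat (n choose k) * [:e:] ^ k * (monom 1 1 * q) ^ (n - k) =
        smult (of_nat (n choose k) * e ^ k) (monom 1 (n - k) * q ^ (n - k))"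
      by (simp add: power_mult_distrib monom_power of_nat_poly poly_const_pow mult_ac)
    moreover have "n - k - k = n - 2 * k" "\<not> n < n - k" "n - (n - k) = k"
      using that by auto
    ultimately show ?thesis
      by (simp only: coeff_smult coeff_monom_mult q_def coeff_linear_power_eq)
        (simp add: power_mult_distrib mult_ac)
  qed
  show ?thesis
    unfolding split binomial_ring coeff_sum by (intro sum.cong refl summand) simp
qed

lemma pcompose_power: "pcompose (p ^ k) q = pcompose p q ^ k"
  for p q :: "'a::comm_semiring_1 poly"
  by (induction k) (simp_all add: pcompose_mult pcompose_1)

text \<open>The \<open>n\<close>-th derivative at \<open>z\<close>, divided by \<open>n!\<close>, is the \<open>n\<close>-th Taylor coefficient at \<open>z\<close>, and
\<open>(z + h)\<^sup>2 - 1 = h\<^sup>2 + 2 z h + (z\<^sup>2 - 1)\<close>.\<close>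

lemma poly_legendre_taylor:
  "poly (legendre n) z = coeff ([:z\<^sup>2 - 1, 2 * z, 1:] ^ n) n / 2 ^ n"
proof -
  define p :: "real poly" where "p = [:-1, 0, 1:] ^ n"
  have comm: "(pderiv ^^ k) (pcompose q [:z, 1:]) = pcompose ((pderiv ^^ k) q) [:z, 1:]"
    for k and q :: "real poly"
    by (induction k) (simp_all add: pderiv_pcompose pderiv_pCons)
  have "poly ((pderiv ^^ n) p) z = coeff ((pderiv ^^ n) (pcompose p [:z, 1:])) 0"
    by (simp add: comm flip: poly_0_coeff_0) (simp add: poly_pcompose)
  also have "\<dots> = fact n * coeff (pcompose p [:z, 1:]) n"
    by (simp add: coeff_higher_pderiv pochhammer_fact)
  also have "pcompose p [:z, 1:] = [:z\<^sup>2 - 1, 2 * z, 1:] ^ n"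
    by (simp add: p_def pcompose_power pcompose_pCons power2_eq_square)
  finally show ?thesis
    by (simp add: legendre_def p_def)
qed

lemma poly_legendre_sum:
  "poly (legendre n) z = (\<Sum>k\<le>n. real (n choose k) * real ((n - k) choose k) *
     (z\<^sup>2 - 1) ^ k * (2 * z) ^ (n - 2 * k)) / 2 ^ n"
  unfolding poly_legendre_taylor coeff_quadratic_power_middle by simp

lemma poly_legendre_eq_coeff:
  assumes "a * e = complex_of_real (z\<^sup>2 - 1)"
  shows "of_real (poly (legendre n) z) = coeff ([:e, 2 * of_real z, a:] ^ n) n / 2 ^ n"
  unfolding poly_legendre_taylor coeff_quadratic_power_middle assms by simp

section \<open>Binary forms and the reproducing property\<close>

text \<open>The polynomial \<open>p\<close> of degree at most \<open>N\<close>, viewed as a binary form of degree \<open>N\<close> and evaluated at \<open>(C, D)\<close>;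
formally \<open>D\<^sup>N p(C / D)\<close>. The arguments are themselves polynomials, in the
polarization variable.\<close>

definition homogenize :: "nat \<Rightarrow> 'a poly \<Rightarrow> 'a poly \<Rightarrow> 'a poly \<Rightarrow> 'a::comm_ring_1 poly" where
  "homogenize N p C D = (\<Sum>k\<le>N. smult (coeff p k) (C ^ k * D ^ (N - k)))"

lemma homogenize_add: "homogenize N (p + q) C D = homogenize N p C D + homogenize N q C D"
  by (simp add: homogenize_def smult_add_left sum.distrib)

lemma homogenize_smult: "homogenize N (smult a p) C D = smult a (homogenize N p C D)"
  by (simp add: poly_eq_iff homogenize_def coeff_sum sum_distrib_left mult_ac)

lemma homogenize_pCons:
  "homogenize (Suc N) (pCons a p) C D = smult a (D ^ Suc N) + C * homogenize N p C D"
  unfolding homogenize_def sum.atMost_Suc_shift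
  by (simp add: sum_distrib_left mult_ac)

lemma homogenize_Suc:
  assumes "degree p \<le> N"
  shows "homogenize (Suc N) p C D = D * homogenize N p C D"
proof -
  have "coeff p (Suc N) = 0" using assms by (intro coeff_eq_0) simp
  then have "homogenize (Suc N) p C D = (\<Sum>k\<le>N. smult (coeff p k) (C ^ k * D ^ (Suc N - k)))"
    by (simp add: homogenize_def)
  also have "\<dots> = (\<Sum>k\<le>N. D * smult (coeff p k) (C ^ k * D ^ (N - k)))"
    by (intro sum.cong refl) (simp add: Suc_diff_le mult_ac)
  finally show ?thesis by (simp add: homogenize_def sum_distrib_left)
qed

lemma degree_quadratic_power_le: "degree ([:q0, q1, q2:] ^ n) \<le> 2 * n"
  for q0 q1 q2 :: "'a::comm_ring_1"
proof -
  have "degree [:q0, q1, q2:] \<le> 2" by simp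
  then have "degree [:q0, q1, q2:] * n \<le> 2 * n" by (rule mult_le_mono1)
  then show ?thesis using degree_power_le[of "[:q0, q1, q2:]" n] by linarith
qed

text \<open>Homogenization is multiplicative; only powers of a quadratic occur here.\<close>

lemma homogenize_quadratic_power:
  "homogenize (2 * n) ([:q0, q1, q2:] ^ n) C D =
    (smult q0 (D\<^sup>2) + smult q1 (C * D) + smult q2 (C\<^sup>2)) ^ n"
proof (induction n)
  case 0
  show ?case by (simp add: homogenize_def)
next
  case (Suc n)
  define p where "p = [:q0, q1, q2:] ^ n"
  have deg: "degree p \<le> 2 * n"
    unfolding p_def by (rule degree_quadratic_power_le)
  have "[:q0, q1, q2:] ^ Suc n = smult q0 p + pCons 0 (smult q1 p + pCons 0 (smult q2 p))"
    by (simp add: p_def)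
  moreover have "homogenize (Suc (Suc (2 * n))) p C D = D\<^sup>2 * homogenize (2 * n) p C D"
    using deg by (simp add: homogenize_Suc power2_eq_square mult_ac)
  moreover have "homogenize (Suc (2 * n)) p C D = D * homogenize (2 * n) p C D"
    using deg by (rule homogenize_Suc)
  ultimately have "homogenize (2 * Suc n) ([:q0, q1, q2:] ^ Suc n) C D =
      (smult q0 (D\<^sup>2) + smult q1 (C * D) + smult q2 (C\<^sup>2)) * homogenize (2 * n) p C D"
    by (simp add: homogenize_add homogenize_smult homogenize_pCons power2_eq_square algebra_simps
        smult_add_right)
  then show ?case using Suc.IH by (simp add: p_def)
qed

text \<open>Both sides are the multinomial coefficient \<open>(2n)! / (i! (k - i)! (n - i)! (n - k + i)!)\<close>.\<close>

lemma choose_reciprocity: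
  assumes "i \<le> n" "i \<le> k" "k - i \<le> n"
  shows "((2 * n) choose k) * ((k choose i) * ((2 * n - k) choose (n - i))) =
    ((2 * n) choose n) * ((n choose i) * (n choose (k - i)))"
proof -
  have "real (((2 * n) choose k) * ((k choose i) * ((2 * n - k) choose (n - i)))) =
    real (((2 * n) choose n) * ((n choose i) * (n choose (k - i))))"
  proof -
    have k: "k \<le> 2 * n" and ni: "n - i \<le> 2 * n - k" "2 * n - k - (n - i) = n - (k - i)" "2 * n - n = n"
      using assms by auto
    show ?thesis
      using assms k ni by (simp add: binomial_fact)
  qed
  then show ?thesis by (simp only: of_nat_eq_iff)
qed

text \<open>Both sides are the coefficient of \<open>\<lambda>\<^sup>n t\<^sup>k\<close> in
\<open>(\<lambda> (a t + c) + (b t + d))\<^sup>2\<^sup>n = (t (\<lambda> a + b) + (\<lambda> c + d))\<^sup>2\<^sup>n\<close>, expanded first in \<open>t\<close> on the left and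
first in \<open>\<lambda>\<close> on the right. This is the polarized form of the reproducing property: it replaces the
coefficients of the product \<open>(a t + c)\<^sup>n (b t + d)\<^sup>n\<close>, weighted by \<open>1 / (2n choose k)\<close>, by monomials in two linear forms.\<close>

lemma coeff_linear_powers_reciprocity:
  fixes a b c d :: "'a::comm_ring_1"
  assumes "k \<le> 2 * n"
  shows "of_nat ((2 * n) choose k) * coeff ([:b, a:] ^ k * [:d, c:] ^ (2 * n - k)) n =
    of_nat ((2 * n) choose n) * coeff ([:c, a:] ^ n * [:d, b:] ^ n) k"
proof -
  have summand: "of_nat ((2 * n) choose k) * (of_nat (k choose i) * a ^ i * b ^ (k - i) *
        (of_nat ((2 * n - k) choose (n - i)) * c ^ (n - i) * d ^ (2 * n - k - (n - i)))) =
      of_nat ((2 * n) choose n) * (of_nat (n choose i) * a ^ i * c ^ (n - i) *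
        (of_nat (n choose (k - i)) * b ^ (k - i) * d ^ (n - (k - i))))"
    if "i \<in> {..min n k}" for i
  proof (cases "k - i \<le> n")
    case True
    then have "(of_nat (((2 * n) choose k) * ((k choose i) * ((2 * n - k) choose (n - i)))) :: 'a) =
        of_nat (((2 * n) choose n) * ((n choose i) * (n choose (k - i))))"
      using that by (subst choose_reciprocity) auto
    then have *: "(of_nat ((2 * n) choose k) * (of_nat (k choose i) * of_nat ((2 * n - k) choose (n - i))) :: 'a) =
        of_nat ((2 * n) choose n) * (of_nat (n choose i) * of_nat (n choose (k - i)))"
      by (simp only: of_nat_mult)
    have e: "2 * n - k - (n - i) = n - (k - i)"
      using that True by auto
    have "of_nat ((2 * n) choose k) * (of_nat (k choose i) * a ^ i * b ^ (k - i) *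
          (of_nat ((2 * n - k) choose (n - i)) * c ^ (n - i) * d ^ (n - (k - i)))) =
        (of_nat ((2 * n) choose k) * (of_nat (k choose i) * of_nat ((2 * n - k) choose (n - i)))) *
          (a ^ i * b ^ (k - i) * c ^ (n - i) * d ^ (n - (k - i)))"
      by (simp only: mult_ac)
    then show ?thesis
      unfolding e * by (simp only: mult_ac)
  next
    case False
    then have "2 * n - k < n - i" using that assms by auto
    then show ?thesis using False by (simp add: binomial_eq_0)
  qed
  have "of_nat ((2 * n) choose k) * coeff ([:b, a:] ^ k * [:d, c:] ^ (2 * n - k)) n =
      (\<Sum>i\<le>n. of_nat ((2 * n) choose k) * (of_nat (k choose i) * a ^ i * b ^ (k - i) *
        (of_nat ((2 * n - k) choose (n - i)) * c ^ (n - i) * d ^ (2 * n - k - (n - i)))))"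
    by (simp add: coeff_mult coeff_linear_power_eq sum_distrib_left)
  also have "\<dots> = (\<Sum>i\<in>{..min n k}. of_nat ((2 * n) choose k) * (of_nat (k choose i) * a ^ i * b ^ (k - i) *
        (of_nat ((2 * n - k) choose (n - i)) * c ^ (n - i) * d ^ (2 * n - k - (n - i)))))"
    by (intro sum.mono_neutral_right ballI) (auto simp: not_le binomial_eq_0)
  also have "\<dots> = (\<Sum>i\<in>{..min n k}. of_nat ((2 * n) choose n) * (of_nat (n choose i) * a ^ i * c ^ (n - i) *
        (of_nat (n choose (k - i)) * b ^ (k - i) * d ^ (n - (k - i)))))"
    by (intro sum.cong refl summand)
  also have "\<dots> = (\<Sum>i\<le>k. of_nat ((2 * n) choose n) * (of_nat (n choose i) * a ^ i * c ^ (n - i) *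
        (of_nat (n choose (k - i)) * b ^ (k - i) * d ^ (n - (k - i)))))"
    by (intro sum.mono_neutral_left ballI) (auto simp: not_le binomial_eq_0)
  also have "\<dots> = of_nat ((2 * n) choose n) * coeff ([:c, a:] ^ n * [:d, b:] ^ n) k"
    by (simp add: coeff_mult coeff_linear_power_eq sum_distrib_left)
  finally show ?thesis .
qed

section \<open>Positive definiteness on the sphere\<close>

text \<open>The quadratic form whose coefficients are, up to scaling, the components of \<open>x\<close> in the weight basis of the spin-one
representation of SU(2). Its discriminant is \<open>4 (x \<bullet> x)\<close>.\<close>

definition sphere_quadric :: "real ^ 3 \<Rightarrow> complex poly" where
  "sphere_quadric x =
    [:- Complex (x $ 1) (- (x $ 2)), - 2 * of_real (x $ 3), Complex (x $ 1) (x $ 2):]"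

lemma cnj_coeff_power:
  fixes p q :: "complex poly"
  assumes "\<And>k. coeff q k = cnj (coeff p k)"
  shows "coeff (q ^ n) k = cnj (coeff (p ^ n) k)"
proof (induction n arbitrary: k)
  case 0
  show ?case by (simp add: coeff_pCons split: nat.split)
next
  case (Suc n)
  then show ?case by (simp add: coeff_mult assms)
qed

lemma sum_squares_of_mem_sphere:
  fixes x :: "real ^ 3"
  assumes "x \<in> sphere 0 1"
  shows "(x $ 1)\<^sup>2 + (x $ 2)\<^sup>2 + (x $ 3)\<^sup>2 = 1"
proof -
  have "x \<bullet> x = 1" using assms by (simp add: norm_eq_1)
  then show ?thesis by (simp add: inner_vec_def sum_3 power2_eq_square)
qed

text \<open>The Hopf fibration is onto. The factor \<open>\<alpha>\<close> is chosen as the nonnegative root of \<open>(1 + y\<^sub>3) / 2\<close>, which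
determines \<open>\<beta>\<close> except at the south pole.\<close>

lemma spinor_exists:
  fixes y :: "real ^ 3"
  assumes "y \<in> sphere 0 1"
  obtains \<alpha> \<beta> :: complex where "2 * cnj \<alpha> * \<beta> = Complex (y $ 1) (y $ 2)"
    "\<alpha> * cnj \<alpha> - \<beta> * cnj \<beta> = of_real (y $ 3)" "\<alpha> * cnj \<alpha> + \<beta> * cnj \<beta> = 1"
proof -
  note sq = sum_squares_of_mem_sphere[OF assms]
  show ?thesis
  proof (cases "y $ 3 = -1")
    case True
    then have "y $ 1 = 0" "y $ 2 = 0"
      using sq by (auto simp: sum_power2_eq_zero_iff)
    then show ?thesis
      using True by (intro that[of 0 1]) (auto simp: complex_eq_iff)
  next
    case False
    have "(y $ 3)\<^sup>2 \<le> 1" using sq sum_power2_ge_zero[of "y $ 1" "y $ 2"] by linarith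
    then have "y $ 3 > -1" using False abs_square_le_1[of "y $ 3"] by linarith
    define r where "r = sqrt ((1 + y $ 3) / 2)"
    have r: "r > 0" "r\<^sup>2 = (1 + y $ 3) / 2"
      using \<open>y $ 3 > -1\<close> by (auto simp: r_def)
    define \<beta> where "\<beta> = Complex (y $ 1) (y $ 2) / of_real (2 * r)"
    have "\<beta> * cnj \<beta> = of_real (((y $ 1)\<^sup>2 + (y $ 2)\<^sup>2) / (4 * r\<^sup>2))"
      by (simp add: \<beta>_def complex_mult_cnj power2_eq_square field_simps complex_eq_iff)
    also have "((y $ 1)\<^sup>2 + (y $ 2)\<^sup>2) / (4 * r\<^sup>2) = (1 - y $ 3) / 2"
    proof -
      have "(y $ 1)\<^sup>2 + (y $ 2)\<^sup>2 = (1 - y $ 3) * (1 + y $ 3)"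
        using sq by (simp add: algebra_simps power2_eq_square)
      then show ?thesis using \<open>y $ 3 > -1\<close> unfolding r(2) by (simp add: field_simps)
    qed
    finally have b: "\<beta> * cnj \<beta> = of_real ((1 - y $ 3) / 2)" .
    have a: "complex_of_real r * cnj (of_real r) = of_real ((1 + y $ 3) / 2)"
      unfolding complex_cnj_complex_of_real of_real_mult[symmetric] r(2)[symmetric] power2_eq_square ..
    show ?thesis
    proof (rule that[of "of_real r" \<beta>])
      show "2 * cnj (of_real r) * \<beta> = Complex (y $ 1) (y $ 2)"
        using r(1) by (simp add: \<beta>_def)
      show "complex_of_real r * cnj (of_real r) - \<beta> * cnj \<beta> = of_real (y $ 3)"
        unfolding a b of_real_diff[symmetric] by (simp add: field_simps)
      show "complex_of_real r * cnj (of_real r) + \<beta> * cnj \<beta> = 1"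
        unfolding a b of_real_add[symmetric] by (simp add: field_simps)
    qed
  qed
qed

text \<open>The right-hand side is the invariant Hermitian product of \<open>Q\<^sub>x\<^sup>n\<close> and \<open>Q\<^sub>y\<^sup>n\<close>. Since the conjugate of \<open>Q\<^sub>y\<close> is twice
a product of linear factors, reciprocity rewrites the product as the coefficient of \<open>\<lambda>\<^sup>n\<close> in
\<open>Q\<^sub>x(C, D)\<^sup>n\<close> with \<open>C\<close>, \<open>D\<close> linear in \<open>\<lambda>\<close>. As a quadratic in \<open>\<lambda>\<close>, \<open>Q\<^sub>x(C, D)\<close> has linear coefficient
\<open>2 (x \<bullet> y)\<close>; the substitution has determinant of modulus \<open>1\<close>, so the discriminant \<open>4\<close> of \<open>Q\<^sub>x\<close> is preserved
and the product of the outer coefficients is \<open>(x \<bullet> y)\<^sup>2 - 1\<close>, as the Taylor form of \<open>P\<^sub>n\<close> requires.\<close>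

lemma legendre_inner_eq_weighted_sum:
  fixes x y :: "real ^ 3"
  assumes x: "x \<in> sphere 0 1" and y: "y \<in> sphere 0 1"
  shows "of_real (poly (legendre n) (x \<bullet> y)) = of_nat ((2 * n) choose n) / 4 ^ n *
    (\<Sum>k\<le>2 * n. coeff (sphere_quadric x ^ n) k * cnj (coeff (sphere_quadric y ^ n) k) /
      of_nat ((2 * n) choose k))"
proof -
  obtain \<alpha> \<beta> :: complex where ab: "2 * cnj \<alpha> * \<beta> = Complex (y $ 1) (y $ 2)"
    "\<alpha> * cnj \<alpha> - \<beta> * cnj \<beta> = of_real (y $ 3)" "\<alpha> * cnj \<alpha> + \<beta> * cnj \<beta> = 1"
    using spinor_exists[OF y] by metis
  have ab': "2 * \<alpha> * cnj \<beta> = Complex (y $ 1) (- (y $ 2))"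
    using arg_cong[OF ab(1), of cnj] by (simp add: complex_eq_iff)
  define z where "z = Complex (x $ 1) (x $ 2)"
  define z' where "z' = Complex (x $ 1) (- (x $ 2))"
  define w where "w = complex_of_real (x $ 3)"
  have zz': "z * z' + w * w = 1"
    using sum_squares_of_mem_sphere[OF x]
    by (simp add: z_def z'_def w_def complex_eq_iff power2_eq_square)
  have Qx: "sphere_quadric x = [:- z', - 2 * w, z:]"
    by (simp add: sphere_quadric_def z_def z'_def w_def)
  define C where "C = [:cnj \<beta>, \<alpha>:]"
  define D where "D = [:- cnj \<alpha>, \<beta>:]"
  \<comment> \<open>\<open>R\<close> is the conjugate of \<open>Q\<^sub>y\<close>, factored by the spinor; \<open>C\<close> and \<open>D\<close> collect the coefficients of \<open>t\<close> and \<open>1\<close>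
    in \<open>\<lambda>\<close> times the first factor plus the second.\<close>
  define R where "R = smult 2 ([:\<beta>, \<alpha>:] * [:- cnj \<alpha>, cnj \<beta>:])"
  have R: "R = [:- Complex (y $ 1) (y $ 2), - 2 * of_real (y $ 3), Complex (y $ 1) (- (y $ 2)):]"
    unfolding ab(1)[symmetric] ab(2)[symmetric] ab'[symmetric] R_def by (simp add: algebra_simps)
  have cnj_Qy: "cnj (coeff (sphere_quadric y ^ n) k) = coeff (R ^ n) k" for k
    by (rule cnj_coeff_power[symmetric])
      (auto simp: R sphere_quadric_def coeff_pCons complex_eq_iff split: nat.split)
  define A where "A = - z' * \<beta>\<^sup>2 - 2 * w * \<alpha> * \<beta> + z * \<alpha>\<^sup>2"
  define E where "E = - z' * (cnj \<alpha>)\<^sup>2 + 2 * w * cnj \<alpha> * cnj \<beta> + z * (cnj \<beta>)\<^sup>2"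
  define B where "B = z' * (2 * cnj \<alpha> * \<beta>) + z * (2 * \<alpha> * cnj \<beta>) + 2 * w * (\<alpha> * cnj \<alpha> - \<beta> * cnj \<beta>)"
  have B: "B = 2 * of_real (x \<bullet> y)"
    unfolding B_def ab ab' z_def z'_def w_def
    by (simp add: complex_eq_iff inner_vec_def sum_3 algebra_simps)
  \<comment> \<open>Invariance of the discriminant under a linear substitution.\<close>
  have "B\<^sup>2 - 4 * (A * E) = 4 * (z * z' + w * w) * (\<alpha> * cnj \<alpha> + \<beta> * cnj \<beta>)\<^sup>2"
    unfolding A_def B_def E_def by algebra
  then have "B\<^sup>2 - 4 * (A * E) = 4" unfolding zz' ab by simp
  then have "4 * (A * E) = 4 * of_real ((x \<bullet> y)\<^sup>2 - 1)"
    unfolding B by (simp add: power2_eq_square algebra_simps)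
  then have AE: "A * E = of_real ((x \<bullet> y)\<^sup>2 - 1)"
    by (simp only: mult_cancel_left) simp
  have quadratic: "smult (- z') (D\<^sup>2) + smult (- 2 * w) (C * D) + smult z (C\<^sup>2) = [:E, B, A:]"
    unfolding A_def B_def E_def C_def D_def by (simp add: power2_eq_square algebra_simps)
  have mid: "coeff (C ^ k * D ^ (2 * n - k)) n =
      of_nat ((2 * n) choose n) / 2 ^ n * (coeff (R ^ n) k / of_nat ((2 * n) choose k))"
    if "k \<le> 2 * n" for k
  proof -
    have "of_nat ((2 * n) choose k) * coeff (C ^ k * D ^ (2 * n - k)) n =
      of_nat ((2 * n) choose n) * coeff ([:\<beta>, \<alpha>:] ^ n * [:- cnj \<alpha>, cnj \<beta>:] ^ n) k"
      unfolding C_def D_def using that by (rule coeff_linear_powers_reciprocity)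
    moreover have "coeff (R ^ n) k = 2 ^ n * coeff ([:\<beta>, \<alpha>:] ^ n * [:- cnj \<alpha>, cnj \<beta>:] ^ n) k"
      unfolding R_def by (simp only: smult_power power_mult_distrib coeff_smult)
    moreover have "(of_nat ((2 * n) choose k) :: complex) \<noteq> 0"
      using that by (simp add: binomial_eq_0_iff)
    ultimately show ?thesis by (simp add: field_simps)
  qed
  have "of_real (poly (legendre n) (x \<bullet> y)) = coeff ([:E, B, A:] ^ n) n / 2 ^ n"
    unfolding B by (rule poly_legendre_eq_coeff[OF AE])
  also have "[:E, B, A:] ^ n = homogenize (2 * n) (sphere_quadric x ^ n) C D"
    unfolding Qx homogenize_quadratic_power quadratic ..
  also have "coeff \<dots> n = (\<Sum>k\<le>2 * n. coeff (sphere_quadric x ^ n) k * coeff (C ^ k * D ^ (2 * n - k)) n)"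
    by (simp add: homogenize_def coeff_sum)
  also have "\<dots> = (\<Sum>k\<le>2 * n. coeff (sphere_quadric x ^ n) k *
      (of_nat ((2 * n) choose n) / 2 ^ n * (coeff (R ^ n) k / of_nat ((2 * n) choose k))))"
    by (intro sum.cong refl) (simp add: mid)
  also have "\<dots> / 2 ^ n = of_nat ((2 * n) choose n) / 4 ^ n *
      (\<Sum>k\<le>2 * n. coeff (sphere_quadric x ^ n) k * cnj (coeff (sphere_quadric y ^ n) k) /
        of_nat ((2 * n) choose k))"
    unfolding cnj_Qy sum_distrib_left sum_divide_distrib
    by (intro sum.cong refl) (simp add: field_simps flip: power_mult_distrib)
  finally show ?thesis .
qed

lemma legendre_positive_definite:
  fixes x :: "'i \<Rightarrow> real ^ 3" and c :: "'i \<Rightarrow> real"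
  assumes "\<And>i. i \<in> I \<Longrightarrow> x i \<in> sphere 0 1"
  shows "(\<Sum>i\<in>I. \<Sum>j\<in>I. c i * c j * poly (legendre n) (x i \<bullet> x j)) \<ge> 0"
proof -
  define f where "f k = (\<Sum>i\<in>I. of_real (c i) * coeff (sphere_quadric (x i) ^ n) k)" for k
  define K where "K k = real ((2 * n) choose n) / 4 ^ n / real ((2 * n) choose k)" for k
  have "complex_of_real (\<Sum>i\<in>I. \<Sum>j\<in>I. c i * c j * poly (legendre n) (x i \<bullet> x j)) =
      (\<Sum>i\<in>I. \<Sum>j\<in>I. \<Sum>k\<le>2 * n. of_real (K k) * ((of_real (c i) * coeff (sphere_quadric (x i) ^ n) k) *
        cnj (of_real (c j) * coeff (sphere_quadric (x j) ^ n) k)))"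
    unfolding of_real_sum of_real_mult
  proof (intro sum.cong refl)
    fix i j assume "i \<in> I" "j \<in> I"
    then show "of_real (c i) * of_real (c j) * complex_of_real (poly (legendre n) (x i \<bullet> x j)) =
        (\<Sum>k\<le>2 * n. of_real (K k) * ((of_real (c i) * coeff (sphere_quadric (x i) ^ n) k) *
          cnj (of_real (c j) * coeff (sphere_quadric (x j) ^ n) k)))"
      unfolding legendre_inner_eq_weighted_sum[OF assms assms, OF \<open>i \<in> I\<close> \<open>j \<in> I\<close>] sum_distrib_left
      by (intro sum.cong refl) (simp add: K_def)
  qed
  also have "\<dots> = (\<Sum>k\<le>2 * n. \<Sum>i\<in>I. \<Sum>j\<in>I. of_real (K k) * ((of_real (c i) * coeff (sphere_quadric (x i) ^ n) k) *
        cnj (of_real (c j) * coeff (sphere_quadric (x j) ^ n) k)))"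
    by (simp only: sum.swap[where A = I and B = "{..2 * n}"])
  also have "\<dots> = (\<Sum>k\<le>2 * n. of_real (K k) * (f k * cnj (f k)))"
    unfolding f_def cnj_sum by (simp only: sum_product) (simp only: sum_distrib_left)
  also have "\<dots> = of_real (\<Sum>k\<le>2 * n. K k * (cmod (f k))\<^sup>2)"
    by (simp add: complex_norm_square[symmetric])
  finally have "(\<Sum>i\<in>I. \<Sum>j\<in>I. c i * c j * poly (legendre n) (x i \<bullet> x j)) =
      (\<Sum>k\<le>2 * n. K k * (cmod (f k))\<^sup>2)"
    by (simp only: of_real_eq_iff)
  also have "\<dots> \<ge> 0"
    by (intro sum_nonneg mult_nonneg_nonneg) (auto simp: K_def)
  finally show ?thesis .
qed

text \<open>Positive definiteness for two points with inner product \<open>t\<close> and coefficients \<open>1\<close>, \<open>\<plusminus>1\<close>.\<close>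

lemma abs_legendre_le_1:
  assumes "\<bar>t\<bar> \<le> 1"
  shows "\<bar>poly (legendre n) t\<bar> \<le> 1"
proof -
  define x :: "real ^ 3" where "x = (\<chi> i. if i = 3 then 1 else 0)"
  define y :: "real ^ 3" where "y = (\<chi> i. if i = 3 then t else if i = 1 then sqrt (1 - t\<^sup>2) else 0)"
  have t: "t\<^sup>2 \<le> 1" using assms by (simp add: abs_square_le_1)
  have xx: "x \<bullet> x = 1" and xy: "x \<bullet> y = t" and yy: "y \<bullet> y = 1"
    using t by (auto simp: x_def y_def inner_vec_def sum_3 power2_eq_square)
  have sph: "(if b then x else y) \<in> sphere 0 1" for b
    using xx yy by (auto simp: norm_eq_1)
  have "0 \<le> 2 + 2 * s * poly (legendre n) t" if "s\<^sup>2 = 1" for s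
    using legendre_positive_definite[of UNIV "\<lambda>b. if b then x else y" "\<lambda>b. if b then 1 else s" n, OF sph] that
    by (simp add: UNIV_bool xx xy yy inner_commute[of y x] poly_legendre_1 power2_eq_square)
  from this[of 1] this[of "-1"] show ?thesis by simp
qed

section \<open>Estimates from the differential equation\<close>

text \<open>Legendre's equation in Sturm--Liouville form. The power \<open>w = (t\<^sup>2 - 1)\<^sup>n\<close> satisfies
\<open>(t\<^sup>2 - 1) w' = 2 n t w\<close>; differentiating this \<open>k + 1\<close> times gives a recurrence for the derivatives of \<open>w\<close>,
proved by induction on \<open>k\<close>, and the case \<open>k = n\<close> is the claim.\<close>

lemma legendre_ode:
  "pderiv ([:1, 0, -1:] * pderiv (legendre n)) = smult (- real (n * (n + 1))) (legendre n)"
proof -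
  define w :: "real poly" where "w = [:-1, 0, 1:] ^ n"
  define D where "D k = (pderiv ^^ k) w" for k
  have D_Suc: "pderiv (D k) = D (Suc k)" for k by (simp add: D_def)
  have rec: "[:-1, 0, 1:] * D (Suc (Suc k)) + smult (2 * real (Suc k) - 2 * real n) ([:0, 1:] * D (Suc k)) +
      smult (real (Suc k) * real k - 2 * real n * real (Suc k)) (D k) = 0" for k
  proof (induction k)
    case 0
    have "[:-1, 0, 1:] * D (Suc 0) = smult (2 * real n) ([:0, 1:] * D 0)"
    proof (cases n)
      case 0
      then show ?thesis by (simp add: D_def w_def)
    next
      case (Suc m)
      define q :: "real poly" where "q = [:-1, 0, 1:]"
      have q': "pderiv q = smult 2 [:0, 1:]" by (simp add: q_def pderiv_pCons)
      have "q * pderiv (q ^ Suc m) = smult (2 * real (Suc m)) ([:0, 1:] * q ^ Suc m)"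
        unfolding pderiv_power_Suc q' by (simp add: algebra_simps smult_add_right smult_add_left)
      then show ?thesis unfolding D_def w_def Suc q_def by simp
    qed
    from arg_cong[OF this, of pderiv] show ?case
      by (simp add: pderiv_mult pderiv_smult pderiv_pCons pderiv_add pderiv_diff pderiv_minus D_Suc poly_eq_poly_eq_iff[symmetric] fun_eq_iff algebra_simps)
  next
    case (Suc k)
    from arg_cong[OF this, of pderiv] show ?case
      by (simp add: pderiv_mult pderiv_smult pderiv_pCons pderiv_add pderiv_diff pderiv_minus D_Suc poly_eq_poly_eq_iff[symmetric] fun_eq_iff algebra_simps)
  qed
  have L: "legendre n = smult (1 / (2 ^ n * fact n)) (D n)"
    by (simp add: legendre_def D_def w_def)
  have "pderiv ([:1, 0, -1:] * D (Suc n)) = smult (- real (n * (n + 1))) (D n)"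
    using rec[of n]
    by (simp add: pderiv_mult pderiv_pCons pderiv_add pderiv_diff pderiv_minus D_Suc poly_eq_poly_eq_iff[symmetric] fun_eq_iff algebra_simps)
  then show ?thesis
    unfolding L by (simp add: pderiv_smult D_Suc mult_ac)
qed

text \<open>With \<open>\<Lambda> = n (n + 1)\<close> and \<open>y = P\<^sub>n\<close>, the energy \<open>\<Lambda> y\<^sup>2 + (1 - u\<^sup>2) y'\<^sup>2\<close> grows away from \<open>0\<close>, but its product with
\<open>1 - u\<^sup>2\<close> has derivative \<open>-2 u \<Lambda> y\<^sup>2\<close> and hence decreases.\<close>

lemma legendre_energy:
  assumes "0 \<le> u" "u \<le> 1"
  shows "(1 - u\<^sup>2) * (real (n * (n + 1)) * (poly (legendre n) u)\<^sup>2 +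
      (1 - u\<^sup>2) * (poly (pderiv (legendre n)) u)\<^sup>2)
    \<le> real (n * (n + 1)) * (poly (legendre n) 0)\<^sup>2 + (poly (pderiv (legendre n)) 0)\<^sup>2"
proof -
  define L where "L = real (n * (n + 1))"
  define y where "y = poly (legendre n)"
  define v where "v t = (1 - t\<^sup>2) * poly (pderiv (legendre n)) t" for t
  have y': "(y has_real_derivative poly (pderiv (legendre n)) t) (at t)" for t
    unfolding y_def by (rule poly_DERIV)
  have v': "(v has_real_derivative - L * y t) (at t)" for t
  proof -
    have "v = poly ([:1, 0, -1:] * pderiv (legendre n))"
      by (auto simp: v_def fun_eq_iff power2_eq_square algebra_simps)
    then show ?thesis
      using poly_DERIV[of "[:1, 0, -1:] * pderiv (legendre n)" t]
      by (simp only: legendre_ode poly_smult L_def y_def)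
  qed
  define G where "G t = (1 - t\<^sup>2) * (L * (y t)\<^sup>2) + (v t)\<^sup>2" for t
  have "(G has_real_derivative - 2 * t * L * (y t)\<^sup>2) (at t)" for t
    unfolding G_def
    by (rule derivative_eq_intros y' v' refl)+ (simp add: v_def power2_eq_square algebra_simps)
  moreover have "- 2 * t * L * (y t)\<^sup>2 \<le> 0" if "0 \<le> t" for t
    using that by (simp add: L_def)
  ultimately have "G u \<le> G 0"
    using assms by (intro DERIV_nonpos_imp_nonincreasing[of 0 u G]) blast+
  then show ?thesis
    by (simp add: G_def v_def L_def y_def power2_eq_square algebra_simps)
qed

lemma abs_legendre_le_deriv_0:
  assumes "poly (legendre n) 0 = 0" "0 \<le> u" "u \<le> 1 / 2" "n > 0"
  shows "\<bar>poly (legendre n) u\<bar> \<le> 2 * \<bar>poly (pderiv (legendre n)) 0\<bar> / real n"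
proof -
  define y d where "y = poly (legendre n) u" and "d = poly (pderiv (legendre n)) 0"
  have u2: "u\<^sup>2 \<le> 1 / 4"
    using power_mono[of u "1 / 2" 2] assms by (simp add: power2_eq_square)
  have "(1 / 4) * (real n * real n * y\<^sup>2) \<le> (1 - u\<^sup>2) * (real (n * (n + 1)) * y\<^sup>2)"
    using u2 by (intro mult_mono mult_nonneg_nonneg) (auto simp: algebra_simps)
  also have "\<dots> \<le> d\<^sup>2"
  proof -
    have "0 \<le> (1 - u\<^sup>2) * ((1 - u\<^sup>2) * (poly (pderiv (legendre n)) u)\<^sup>2)"
      using u2 by (intro mult_nonneg_nonneg) auto
    moreover have "(1 - u\<^sup>2) * (real (n * (n + 1)) * y\<^sup>2 + (1 - u\<^sup>2) * (poly (pderiv (legendre n)) u)\<^sup>2) \<le> d\<^sup>2"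
      using legendre_energy[of u n] assms by (simp add: y_def d_def)
    ultimately show ?thesis by (simp only: distrib_left)
  qed
  finally have "(real n * y)\<^sup>2 \<le> (2 * d)\<^sup>2"
    by (simp add: power2_eq_square algebra_simps)
  then have "\<bar>real n * y\<bar> \<le> \<bar>2 * d\<bar>" by (simp only: abs_le_square_iff)
  then show ?thesis using assms by (simp add: abs_mult y_def d_def field_simps)
qed

text \<open>The energy bounds \<open>y'\<close> by \<open>2 y'(0)\<close>, hence \<open>y\<close> by \<open>2 y'(0) u\<close>. Inserted into the differential equation
\<open>((1 - u\<^sup>2) y')' = - n (n + 1) y\<close>, this shows that \<open>y'\<close> stays above half its initial value as long as \<open>n (n + 1) u\<^sup>2\<close> is
at most \<open>1/4\<close>.\<close>

lemma legendre_ge_linear: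
  assumes 0: "poly (legendre n) 0 = 0" and d: "poly (pderiv (legendre n)) 0 \<ge> 0"
    and u: "0 < u" "u \<le> 1 / 2" and small: "real (n * (n + 1)) * u\<^sup>2 \<le> 1 / 4"
  shows "poly (legendre n) u \<ge> poly (pderiv (legendre n)) 0 * u / 2"
proof -
  define L where "L = real (n * (n + 1))"
  define y d where "y = poly (legendre n)" and "d = poly (pderiv (legendre n)) 0"
  define y' where "y' = poly (pderiv (legendre n))"
  have der: "(y has_real_derivative y' t) (at t)" for t
    unfolding y_def y'_def by (rule poly_DERIV)
  have mvt: "\<exists>s. 0 < s \<and> s < t \<and> y t = t * y' s" if "0 < t" for t
    using MVT2[OF that, of y y'] der 0 by (auto simp: y_def)
  have sq: "t\<^sup>2 \<le> 1 / 4" if "0 < t" "t \<le> u" for t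
    using power_mono[of t "1 / 2" 2] that u by (simp add: power2_eq_square)
  have y'_le: "y' t \<le> 2 * d" if t: "0 < t" "t \<le> u" for t
  proof -
    have "((1 - t\<^sup>2) * y' t)\<^sup>2 \<le> d\<^sup>2"
    proof -
      have "(1 - t\<^sup>2) * (L * (y t)\<^sup>2) \<ge> 0"
        using sq[OF t] by (simp add: L_def)
      then show ?thesis
        using legendre_energy[of t n] t u 0
        unfolding y_def d_def y'_def L_def by (simp add: power2_eq_square algebra_simps)
    qed
    then have "\<bar>(1 - t\<^sup>2) * y' t\<bar> \<le> d"
      using d by (simp only: abs_le_square_iff[symmetric] d_def)
    moreover have "1 / 2 * \<bar>y' t\<bar> \<le> \<bar>(1 - t\<^sup>2) * y' t\<bar>"
      unfolding abs_mult using sq[OF t] by (intro mult_right_mono) auto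
    ultimately show ?thesis by linarith
  qed
  have y_le: "y t \<le> 2 * d * u" if t: "0 < t" "t \<le> u" for t
  proof -
    obtain s where "0 < s" "s < t" "y t = t * y' s" using mvt t by blast
    moreover from this have "t * y' s \<le> t * (2 * d)"
      using y'_le[of s] t by (intro mult_left_mono) auto
    moreover have "t * (2 * d) \<le> u * (2 * d)"
      using t d by (intro mult_right_mono) (auto simp: d_def)
    ultimately have "y t \<le> u * (2 * d)" by linarith
    then show ?thesis by (simp add: mult_ac)
  qed
  have y'_ge: "y' t \<ge> d / 2" if t: "0 < t" "t \<le> u" for t
  proof -
    define v where "v = poly ([:1, 0, -1:] * pderiv (legendre n))"
    have v: "v s = (1 - s\<^sup>2) * y' s" for s
      by (auto simp: v_def y'_def power2_eq_square algebra_simps)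
    have "(v has_real_derivative - L * y s) (at s)" for s
      using poly_DERIV[of "[:1, 0, -1:] * pderiv (legendre n)" s]
      by (simp only: v_def legendre_ode poly_smult L_def y_def)
    then obtain s where s: "0 < s" "s < t" "v t - v 0 = t * (- L * y s)"
      using MVT2[OF t(1), of v "\<lambda>s. - L * y s"] by auto
    have "t * (L * y s) \<le> u * (L * (2 * d * u))"
    proof -
      have "t * (L * y s) \<le> t * (L * (2 * d * u))"
        using s t y_le[of s] by (intro mult_left_mono) (auto simp: L_def)
      also have "\<dots> \<le> u * (L * (2 * d * u))"
        using t u d by (intro mult_right_mono) (auto simp: L_def d_def)
      finally show ?thesis .
    qed
    also have "\<dots> = (L * u\<^sup>2) * (2 * d)" by (simp add: power2_eq_square mult_ac)
    also have "\<dots> \<le> (1 / 4) * (2 * d)"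
      using small d by (intro mult_right_mono) (auto simp: L_def d_def)
    finally have "v t \<ge> d / 2" using s(3) v[of 0] by (simp add: d_def y'_def)
    then have "(1 - t\<^sup>2) * y' t \<ge> d / 2" by (simp add: v)
    moreover have "y' t \<ge> 0"
    proof -
      have "1 - t\<^sup>2 > 0" using sq[OF t] by linarith
      moreover have "(1 - t\<^sup>2) * y' t \<ge> 0" using \<open>(1 - t\<^sup>2) * y' t \<ge> d / 2\<close> d by (simp add: d_def)
      ultimately show ?thesis by (simp only: zero_le_mult_iff) linarith
    qed
    then have "(1 - t\<^sup>2) * y' t \<le> 1 * y' t"
      by (intro mult_right_mono) auto
    ultimately show ?thesis by linarith
  qed
  obtain s where "0 < s" "s < u" "y u = u * y' s" using mvt u by blast
  moreover from this have "u * (d / 2) \<le> u * y' s"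
    using y'_ge[of s] u by (intro mult_left_mono) auto
  ultimately show ?thesis by (simp add: y_def d_def mult_ac)
qed

section \<open>Slopes at the origin\<close>

lemma legendre_odd_0:
  assumes "odd n"
  shows "poly (legendre n) 0 = 0"
proof -
  have "real (n choose k) * real ((n - k) choose k) * (0\<^sup>2 - 1) ^ k * (2 * 0) ^ (n - 2 * k) = 0"
    for k
  proof (cases "2 * k < n")
    case True
    then show ?thesis by (simp add: power_0_left)
  next
    case False
    moreover have "2 * k \<noteq> n" using assms by auto
    ultimately have "n - k < k \<or> n < k" by auto
    then show ?thesis by (auto simp: binomial_eq_0)
  qed
  then show ?thesis unfolding poly_legendre_sum by (simp only: sum.neutral_const div_0)
qed

text \<open>In the explicit sum only the summand with a single factor \<open>2 z\<close> has a nonzero derivative at \<open>0\<close>. Its index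
\<open>2 j\<close> is even, so the sign is positive; for degrees \<open>4 j + 3\<close> it would be negative.\<close>

lemma pderiv_legendre_0:
  "poly (pderiv (legendre (4 * j + 1))) 0 =
    (2 * real j + 1) * real ((4 * j + 1) choose (2 * j)) / 4 ^ (2 * j)"
proof -
  define n where "n = 4 * j + 1"
  define b where "b k = real (n choose k) * real ((n - k) choose k)" for k
  have term_deriv: "((\<lambda>z. b k * (z\<^sup>2 - 1) ^ k * (2 * z) ^ (n - 2 * k)) has_real_derivative
      (if k = 2 * j then 2 * b k else 0)) (at 0)" for k
  proof -
    define m where "m = n - 2 * k"
    have base: "((\<lambda>z::real. b k * (z\<^sup>2 - 1) ^ k) has_real_derivative 0) (at 0)"
      by (auto intro!: derivative_eq_intros)
    have "((\<lambda>z::real. 2 * z) has_real_derivative 2) (at 0)"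
      by (auto intro!: derivative_eq_intros)
    from DERIV_power[OF this, of m]
    have pow: "((\<lambda>z::real. (2 * z) ^ m) has_real_derivative real m * 0 ^ (m - 1) * 2) (at 0)"
      by (simp add: mult_ac)
    have "((\<lambda>z. b k * (z\<^sup>2 - 1) ^ k * (2 * z) ^ m) has_real_derivative
        b k * (-1) ^ k * (real m * 0 ^ (m - 1) * 2)) (at 0)"
      using DERIV_mult[OF base pow] by (simp add: mult_ac)
    moreover have "b k * (-1) ^ k * (real m * 0 ^ (m - 1) * 2) = (if k = 2 * j then 2 * b k else 0)"
    proof (cases "k = 2 * j")
      case True
      then have "m = 1" by (simp add: m_def n_def)
      then show ?thesis using True by simp
    next
      case False
      then have "m = 0 \<or> m - 1 \<noteq> 0" unfolding m_def n_def by presburger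
      then show ?thesis using False by (auto simp: power_0_left)
    qed
    ultimately show ?thesis by (simp only: m_def)
  qed
  have "((\<lambda>z. (\<Sum>k\<le>n. b k * (z\<^sup>2 - 1) ^ k * (2 * z) ^ (n - 2 * k)) / 2 ^ n) has_real_derivative
      (\<Sum>k\<le>n. if k = 2 * j then 2 * b k else 0) / 2 ^ n) (at 0)"
    by (intro DERIV_cdivide DERIV_sum term_deriv)
  moreover have "(\<lambda>z. (\<Sum>k\<le>n. b k * (z\<^sup>2 - 1) ^ k * (2 * z) ^ (n - 2 * k)) / 2 ^ n) = poly (legendre n)"
    by (simp add: poly_legendre_sum b_def fun_eq_iff)
  ultimately have "(poly (legendre n) has_real_derivative
      (\<Sum>k\<le>n. if k = 2 * j then 2 * b k else 0) / 2 ^ n) (at 0)"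
    by (simp only:)
  from DERIV_unique[OF poly_DERIV this]
  have "poly (pderiv (legendre n)) 0 = (\<Sum>k\<le>n. if k = 2 * j then 2 * b k else 0) / 2 ^ n" .
  also have "\<dots> = 2 * b (2 * j) / 2 ^ n" by (simp add: n_def)
  also have "\<dots> = (2 * real j + 1) * real ((4 * j + 1) choose (2 * j)) / 4 ^ (2 * j)"
  proof -
    have "n - 2 * j = Suc (2 * j)" by (simp add: n_def)
    then have "b (2 * j) = real (n choose (2 * j)) * (2 * real j + 1)"
      unfolding b_def by simp
    moreover have "(2::real) ^ n = 2 * 4 ^ (2 * j)"
      by (simp add: n_def power_mult)
    ultimately show ?thesis by (simp add: n_def)
  qed
  finally show ?thesis unfolding n_def .
qed

lemma central_binomial_Suc:
  "real ((2 * Suc m) choose Suc m) / 4 ^ Suc m =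
    real ((2 * m) choose m) / 4 ^ m * ((2 * real m + 1) / (2 * real m + 2))"
proof -
  have Suc_m: "real ((2 * Suc m) choose Suc m) = fact (Suc (Suc (2 * m))) / (fact (Suc m) * fact (Suc m))"
    by (subst binomial_fact) auto
  have m: "real ((2 * m) choose m) = fact (2 * m) / (fact m * fact m)"
    by (subst binomial_fact) (auto simp: mult_2)
  show ?thesis
    unfolding Suc_m m fact_Suc power_Suc by (simp add: divide_simps) (simp add: algebra_simps)
qed

text \<open>The central binomial coefficient divided by \<open>4\<^sup>m\<close> is of order \<open>1 / \<surd>m\<close>. The two bounds are in
the form in which the ratio of consecutive terms proves them by induction.\<close>

lemma central_binomial_lower: "m > 0 \<Longrightarrow> 4 * real m * (real ((2 * m) choose m) / 4 ^ m)\<^sup>2 \<ge> 1"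
proof (induction m rule: nat_induct_non_zero)
  case 1
  show ?case by (simp add: power2_eq_square)
next
  case (Suc m)
  define c where "c = real ((2 * m) choose m) / 4 ^ m"
  have "4 * real m \<le> 4 * real (Suc m) * ((2 * real m + 1) / (2 * real m + 2))\<^sup>2"
    by (simp add: power2_eq_square divide_simps) (simp add: algebra_simps)
  then have "4 * real m * c\<^sup>2 \<le> 4 * real (Suc m) * ((2 * real m + 1) / (2 * real m + 2))\<^sup>2 * c\<^sup>2"
    by (rule mult_right_mono) simp
  also have "\<dots> = 4 * real (Suc m) * (c * ((2 * real m + 1) / (2 * real m + 2)))\<^sup>2"
    by (simp only: power_mult_distrib mult_ac)
  finally show ?case using Suc.IH unfolding central_binomial_Suc c_def[symmetric] by linarith
qed

lemma central_binomial_upper: "(2 * real m + 1) * (real ((2 * m) choose m) / 4 ^ m)\<^sup>2 \<le> 1"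
proof (induction m)
  case 0
  show ?case by simp
next
  case (Suc m)
  define c where "c = real ((2 * m) choose m) / 4 ^ m"
  have "(2 * real (Suc m) + 1) * ((2 * real m + 1) / (2 * real m + 2))\<^sup>2 \<le> 2 * real m + 1"
    by (simp add: power2_eq_square divide_simps) (simp add: algebra_simps)
  then have "(2 * real (Suc m) + 1) * ((2 * real m + 1) / (2 * real m + 2))\<^sup>2 * c\<^sup>2 \<le> (2 * real m + 1) * c\<^sup>2"
    by (rule mult_right_mono) simp
  moreover have "(2 * real (Suc m) + 1) * ((2 * real m + 1) / (2 * real m + 2))\<^sup>2 * c\<^sup>2 =
      (2 * real (Suc m) + 1) * (c * ((2 * real m + 1) / (2 * real m + 2)))\<^sup>2"
    by (simp only: power_mult_distrib mult_ac)
  ultimately show ?case using Suc.IH unfolding central_binomial_Suc c_def[symmetric] by linarith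
qed

text \<open>With \<open>m = 2 j + 1\<close> the slope equals \<open>2 m\<close> times the central binomial coefficient of \<open>m\<close> over \<open>4\<^sup>m\<close>.\<close>

lemma pderiv_legendre_0_bounds:
  defines "d \<equiv> \<lambda>j. poly (pderiv (legendre (4 * j + 1))) 0"
  shows "sqrt (real (j + 1)) \<le> d j" "d j \<le> 2 * sqrt (real (j + 1))"
proof -
  define m where "m = 2 * j + 1"
  define c where "c = real ((2 * m) choose m) / 4 ^ m"
  have "(2 * m) choose m = 2 * ((4 * j + 1) choose (2 * j))"
  proof -
    have "(4 * j + 1) choose (2 * j + 1) = (4 * j + 1) choose (2 * j)"
      by (subst binomial_symmetric) auto
    moreover have "(2 * m) choose m = Suc (4 * j + 1) choose Suc (2 * j)"
      unfolding m_def by (rule arg_cong2[where f = binomial]) simp_all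
    ultimately show ?thesis by (simp only: binomial_Suc_Suc) simp
  qed
  then have "real ((2 * m) choose m) = 2 * real ((4 * j + 1) choose (2 * j))" by simp
  moreover have "(4::real) ^ m = 4 * 4 ^ (2 * j)" by (simp add: m_def)
  ultimately have "d j = 2 * real m * c"
    unfolding d_def pderiv_legendre_0 c_def by (simp only:) (simp add: m_def field_simps)
  then have d2: "(d j)\<^sup>2 = 4 * (real m)\<^sup>2 * c\<^sup>2" and nonneg: "d j \<ge> 0"
    by (simp_all add: power_mult_distrib) (simp add: c_def)
  have "real m * 1 \<le> real m * (4 * real m * c\<^sup>2)"
    unfolding c_def using central_binomial_lower[of m] by (intro mult_left_mono) (auto simp: m_def)
  also have "\<dots> = (d j)\<^sup>2" unfolding d2 by (simp add: power2_eq_square)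
  finally have "real (j + 1) \<le> (d j)\<^sup>2" by (simp add: m_def)
  with nonneg show "sqrt (real (j + 1)) \<le> d j" by (rule real_le_lsqrt)
  have "(d j)\<^sup>2 \<le> 2 * real m * ((2 * real m + 1) * c\<^sup>2)"
  proof -
    have "2 * real m * ((2 * real m + 1) * c\<^sup>2) = (d j)\<^sup>2 + 2 * real m * c\<^sup>2"
      unfolding d2 by (simp add: power2_eq_square algebra_simps)
    then show ?thesis by simp
  qed
  also have "\<dots> \<le> 2 * real m * 1"
    unfolding c_def using central_binomial_upper[of m] by (intro mult_left_mono) auto
  also have "\<dots> \<le> (2 * sqrt (real (j + 1)))\<^sup>2"
    by (simp add: m_def power_mult_distrib)
  finally show "d j \<le> 2 * sqrt (real (j + 1))"
    by (rule power2_le_imp_le) simp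
qed

section \<open>The function in the class\<close>

lemma summable_powr_three_halves: "summable (\<lambda>j. real (j + 1) powr (-3/2))"
proof -
  have "summable (\<lambda>j. real j powr (-3/2))" by (simp add: summable_real_powr_iff)
  then show ?thesis by (subst (asm) summable_Suc_iff[symmetric]) (simp add: add.commute)
qed

definition normalizer :: real where "normalizer = (\<Sum>l. real (l + 1) powr (-3/2))"

lemma coeff_a_eq: "coeff_a j = real (j + 1) powr (-3/2) / normalizer"
  by (simp add: coeff_a_def normalizer_def)

lemma normalizer_pos: "normalizer > 0"
  unfolding normalizer_def by (rule suminf_pos[OF summable_powr_three_halves]) simp

lemma coeff_a_nonneg: "coeff_a j \<ge> 0"
  using normalizer_pos by (simp add: coeff_a_eq)

lemma coeff_a_sums: "coeff_a sums 1"
  using sums_divide[OF summable_sums[OF summable_powr_three_halves, folded normalizer_def], of normalizer] normalizer_pos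
  by (simp add: coeff_a_eq[abs_def])

lemma phi_term_bound:
  "norm (coeff_a j * poly (legendre (4 * j + 1)) (cos \<theta>)) \<le> coeff_a j"
  using abs_legendre_le_1[of "cos \<theta>" "4 * j + 1"] coeff_a_nonneg[of j]
  by (simp add: abs_mult mult_left_le)

lemma phi_sums: "(\<lambda>j. coeff_a j * poly (legendre (4 * j + 1)) (cos \<theta>)) sums phi \<theta>"
  unfolding phi_def
  by (intro summable_sums summable_comparison_test[OF _ sums_summable[OF coeff_a_sums]])
    (use phi_term_bound in blast)

lemma phi_arccos_sums:
  assumes "\<bar>t\<bar> \<le> 1"
  shows "(\<lambda>j. coeff_a j * poly (legendre (4 * j + 1)) t) sums phi (arccos t)"
  using phi_sums[of "arccos t"] assms by (simp add: cos_arccos_abs)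

lemma continuous_on_phi: "continuous_on A phi"
proof (rule uniform_limit_theorem[OF _ _ sequentially_bot])
  show "uniform_limit A (\<lambda>n \<theta>. \<Sum>j<n. coeff_a j * poly (legendre (4 * j + 1)) (cos \<theta>)) phi sequentially"
    unfolding phi_def[abs_def]
    using phi_term_bound sums_summable[OF coeff_a_sums] by (rule Weierstrass_m_test)
  show "\<forall>\<^sub>F n in sequentially. continuous_on A (\<lambda>\<theta>. \<Sum>j<n. coeff_a j * poly (legendre (4 * j + 1)) (cos \<theta>))"
    by (intro always_eventually allI continuous_intros)
qed

lemma phi_positive_definite:
  fixes x :: "'i \<Rightarrow> real ^ 3" and c :: "'i \<Rightarrow> real"
  assumes "\<And>i. i \<in> I \<Longrightarrow> x i \<in> sphere 0 1"
  shows "(\<Sum>i\<in>I. \<Sum>j\<in>I. c i * c j * phi (arccos (x i \<bullet> x j))) \<ge> 0"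
proof -
  have "\<bar>x i \<bullet> x j\<bar> \<le> 1" if "i \<in> I" "j \<in> I" for i j
    using Cauchy_Schwarz_ineq2[of "x i" "x j"] assms that by simp
  then have sums: "(\<lambda>k. \<Sum>i\<in>I. \<Sum>j\<in>I. c i * c j * (coeff_a k * poly (legendre (4 * k + 1)) (x i \<bullet> x j)))
      sums (\<Sum>i\<in>I. \<Sum>j\<in>I. c i * c j * phi (arccos (x i \<bullet> x j)))"
    by (intro sums_sum sums_mult phi_arccos_sums)
  have nonneg: "(\<Sum>i\<in>I. \<Sum>j\<in>I. c i * c j * (coeff_a k * poly (legendre (4 * k + 1)) (x i \<bullet> x j))) \<ge> 0" for k
  proof -
    have "(\<Sum>i\<in>I. \<Sum>j\<in>I. c i * c j * (coeff_a k * poly (legendre (4 * k + 1)) (x i \<bullet> x j))) =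
        coeff_a k * (\<Sum>i\<in>I. \<Sum>j\<in>I. c i * c j * poly (legendre (4 * k + 1)) (x i \<bullet> x j))"
      unfolding sum_distrib_left by (intro sum.cong refl) (simp only: mult_ac)
    then show ?thesis
      using mult_nonneg_nonneg[OF coeff_a_nonneg legendre_positive_definite[OF assms]] by (simp only:)
  qed
  show ?thesis
    by (rule sums_le[OF nonneg sums_zero sums])
qed

lemma phi_mem_Psi2: "phi \<in> Psi2"
proof -
  have "phi 0 = 1"
    using coeff_a_sums by (simp add: phi_def poly_legendre_1 sums_iff)
  then show ?thesis
    unfolding Psi2_def using continuous_on_phi by (auto intro!: phi_positive_definite)
qed

section \<open>Unbounded difference quotients\<close>

lemma coeff_a_mult_sqrt: "coeff_a j * sqrt (real (j + 1)) = 1 / (normalizer * real (j + 1))"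
proof -
  have "real (j + 1) powr (-3/2) * sqrt (real (j + 1)) = real (j + 1) powr (-3/2 + 1/2)"
    unfolding powr_add by (subst powr_half_sqrt) simp_all
  also have "-3/2 + 1/2 = (-1::real)" by simp
  also have "real (j + 1) powr (-1) = 1 / real (j + 1)"
    by (subst powr_minus) (simp add: inverse_eq_divide)
  finally show ?thesis
    unfolding coeff_a_eq times_divide_eq_left by (simp only: divide_divide_eq_left mult.commute)
qed

text \<open>The exponent \<open>3/2\<close> is exactly such that the slopes, of order \<open>\<surd>(j + 1)\<close>, turn the coefficients into a
harmonic series.\<close>

lemma coeff_a_mult_deriv_bounds:
  defines "d \<equiv> \<lambda>j. poly (pderiv (legendre (4 * j + 1))) 0"
  shows "1 / (normalizer * real (j + 1)) \<le> coeff_a j * d j"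
    and "coeff_a j * d j \<le> 2 / (normalizer * real (j + 1))"
proof -
  have b: "sqrt (real (j + 1)) \<le> d j" "d j \<le> 2 * sqrt (real (j + 1))"
    unfolding d_def by (rule pderiv_legendre_0_bounds)+
  show "1 / (normalizer * real (j + 1)) \<le> coeff_a j * d j"
    using mult_left_mono[OF b(1) coeff_a_nonneg[of j]] unfolding coeff_a_mult_sqrt .
  have "coeff_a j * d j \<le> 2 * (coeff_a j * sqrt (real (j + 1)))"
    using mult_left_mono[OF b(2) coeff_a_nonneg[of j]] by (simp only: mult_ac)
  then show "coeff_a j * d j \<le> 2 / (normalizer * real (j + 1))"
    unfolding coeff_a_mult_sqrt by simp
qed

lemma telescoping_tail_sums:
  "(\<lambda>i. 1 / real (Suc (N + i)) - 1 / real (Suc (Suc (N + i)))) sums (1 / real (Suc N))"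
proof -
  have "(\<lambda>i. 1 / real (Suc (N + i))) \<longlonglongrightarrow> 0"
    using LIMSEQ_ignore_initial_segment[OF LIMSEQ_inverse_real_of_nat, of N]
    by (simp add: inverse_eq_divide add.commute)
  from telescope_sums'[OF this] show ?thesis by (simp only: add_Suc_right add_0_right diff_zero)
qed

text \<open>At this \<open>u\<close> every degree \<open>4 j + 1\<close> with \<open>j \<le> N\<close> is still in the linear regime of
\<open>legendre_ge_linear\<close>, since \<open>4 j + 2 \<le> 8 (N + 1)\<close> and \<open>8 (N + 1) u = 1/2\<close>. These terms produce the harmonic number.
The terms \<open>j > N\<close> are bounded by the telescoping series \<open>1 / j - 1 / (j + 1)\<close>, whose sum
\<open>1 / (N + 1) = 16 u\<close> costs only a constant after division by \<open>u\<close>.\<close>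

lemma phi_quotient_lower_bound:
  defines "u \<equiv> \<lambda>N. 1 / (16 * real (N + 1))"
  shows "phi (arccos (u N)) / u N \<ge> harm (N + 1) / (2 * normalizer) - 64 / normalizer"
proof -
  define d where "d j = poly (pderiv (legendre (4 * j + 1))) 0" for j
  define t where "t j = coeff_a j * poly (legendre (4 * j + 1)) (u N)" for j
  have u: "0 < u N" "u N \<le> 1 / 2"
    by (auto simp: u_def field_simps)
  have d_pos: "d j \<ge> 0" for j
    using pderiv_legendre_0_bounds(1)[of j] unfolding d_def by (meson order_trans real_sqrt_ge_zero of_nat_0_le_iff)
  have L0: "poly (legendre (4 * j + 1)) 0 = 0" for j by (rule legendre_odd_0) simp
  have sums: "t sums phi (arccos (u N))"
    unfolding t_def using u by (intro phi_arccos_sums) auto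
  have head: "t j \<ge> u N / (2 * normalizer) * inverse (real (Suc j))" if "j \<le> N" for j
  proof -
    have "real ((4 * j + 1) * (4 * j + 1 + 1)) * (u N)\<^sup>2 \<le> real (8 * (N + 1) * (8 * (N + 1))) * (u N)\<^sup>2"
      using that by (intro mult_right_mono of_nat_mono mult_le_mono) auto
    also have "\<dots> = 1 / 4" by (simp add: u_def power2_eq_square divide_simps) (simp add: algebra_simps)
    finally have "poly (legendre (4 * j + 1)) (u N) \<ge> d j * u N / 2"
      unfolding d_def using d_pos[of j] u by (intro legendre_ge_linear L0) (auto simp: d_def)
    from mult_left_mono[OF this coeff_a_nonneg[of j]]
    have "t j \<ge> (coeff_a j * d j) * (u N / 2)" by (simp add: t_def mult_ac)
    moreover have "(coeff_a j * d j) * (u N / 2) \<ge> 1 / (normalizer * real (j + 1)) * (u N / 2)"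
      unfolding d_def using coeff_a_mult_deriv_bounds(1)[of j] u by (intro mult_right_mono) auto
    moreover have "1 / (normalizer * real (j + 1)) * (u N / 2) = u N / (2 * normalizer) * inverse (real (Suc j))"
      by (simp only: Suc_eq_plus1 divide_inverse inverse_mult_distrib mult_1_left mult_ac)
    ultimately show ?thesis by linarith
  qed
  have tail: "t (Suc (N + i)) \<ge> - (4 / normalizer * (1 / real (Suc (N + i)) - 1 / real (Suc (Suc (N + i)))))" for i
  proof -
    define j where "j = Suc (N + i)"
    have j: "real j > 0" by (simp add: j_def)
    have "\<bar>poly (legendre (4 * j + 1)) (u N)\<bar> \<le> 2 * d j / real (4 * j + 1)"
      using abs_legendre_le_deriv_0[of "4 * j + 1" "u N", OF L0] u d_pos[of j] by (simp add: d_def)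
    from mult_left_mono[OF this coeff_a_nonneg[of j]]
    have "\<bar>t j\<bar> \<le> (coeff_a j * d j) * (2 / real (4 * j + 1))"
      using coeff_a_nonneg[of j] by (simp add: t_def abs_mult mult_ac)
    also have "\<dots> \<le> 2 / (normalizer * real (j + 1)) * (2 / real (4 * j + 1))"
      unfolding d_def by (intro mult_right_mono coeff_a_mult_deriv_bounds(2)) auto
    also have "\<dots> \<le> 2 / (normalizer * real (j + 1)) * (2 / real j)"
      using j normalizer_pos by (intro mult_left_mono divide_left_mono) auto
    also have "\<dots> = 4 / normalizer * (1 / (real j * real (j + 1)))"
      by simp
    also have "1 / (real j * real (j + 1)) = 1 / real j - 1 / real (Suc j)"
      using j by (simp add: field_simps)
    finally show ?thesis by (simp add: j_def)
  qed
  have "(\<lambda>i. t (i + Suc N)) sums (phi (arccos (u N)) - (\<Sum>j<Suc N. t j))"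
    using sums by (simp only: sums_iff_shift) simp
  then have "(\<lambda>i. t (Suc (N + i))) sums (phi (arccos (u N)) - (\<Sum>j<Suc N. t j))"
    by (simp add: add.commute)
  from sums_le[OF tail sums_minus[OF sums_mult[OF telescoping_tail_sums]] this]
  have "phi (arccos (u N)) \<ge> (\<Sum>j<Suc N. t j) - 4 / normalizer * (1 / real (Suc N))"
    by simp
  moreover have "1 / real (Suc N) = 16 * u N"
    by (simp add: u_def divide_simps)
  ultimately have "phi (arccos (u N)) \<ge> (\<Sum>j<Suc N. t j) - 4 / normalizer * (16 * u N)"
    by (simp only:)
  moreover have "(\<Sum>j<Suc N. t j) \<ge> u N / (2 * normalizer) * harm (Suc N)"
    unfolding harm_altdef sum_distrib_left by (intro sum_mono head) auto
  ultimately have "phi (arccos (u N)) \<ge> u N / (2 * normalizer) * harm (Suc N) - 4 / normalizer * (16 * u N)"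
    by linarith
  also have "u N / (2 * normalizer) * harm (Suc N) - 4 / normalizer * (16 * u N) =
      (harm (N + 1) / (2 * normalizer) - 64 / normalizer) * u N"
    by (simp add: left_diff_distrib right_diff_distrib mult.commute)
  finally have "phi (arccos (u N)) \<ge> (harm (N + 1) / (2 * normalizer) - 64 / normalizer) * u N" .
  then show ?thesis using u by (simp add: pos_le_divide_eq)
qed

theorem proposition4p3:
  shows "phi \<in> Psi2 \<and> \<not> (\<exists>D. (phi has_real_derivative D) (at (pi / 2)))"
proof (intro conjI notI)
  show "phi \<in> Psi2" by (rule phi_mem_Psi2)
  assume "\<exists>D. (phi has_real_derivative D) (at (pi / 2))"
  then obtain D where D: "(phi has_real_derivative D) (at (pi / 2))" ..
  define u where "u N = 1 / (16 * real (N + 1))" for N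
  have phi_0: "phi (arccos 0) = 0"
  proof -
    have "poly (legendre (4 * j + 1)) 0 = 0" for j by (rule legendre_odd_0) simp
    then show ?thesis using phi_arccos_sums[of 0] by (simp add: sums_iff)
  qed
  \<comment> \<open>In the variable \<open>u = cos \<theta>\<close> the derivative at \<open>0\<close> is \<open>- D\<close>, so the quotients along any sequence tending
    to \<open>0\<close> would be bounded, and with them the harmonic numbers.\<close>
  have "((\<lambda>u. phi (arccos u)) has_real_derivative D * inverse (- sqrt (1 - 0\<^sup>2))) (at 0)"
    using D by (intro DERIV_chain2[of phi D arccos] DERIV_arccos) (auto simp: arccos_0)
  then have "((\<lambda>h. phi (arccos h) / h) \<longlongrightarrow> - D) (at 0)"
    by (simp add: DERIV_def phi_0[unfolded arccos_0])
  moreover have "filterlim u (at 0) sequentially"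
  proof -
    have "u \<longlonglongrightarrow> 0"
    proof -
      have "u = (\<lambda>N. 1 / 16 * inverse (real (Suc N)))"
        by (rule ext) (simp add: u_def inverse_eq_divide del: of_nat_Suc)
      then show ?thesis
        using tendsto_mult_right_zero[OF LIMSEQ_inverse_real_of_nat] by (simp only:)
    qed
    then show ?thesis by (auto simp: filterlim_at u_def)
  qed
  ultimately have "(\<lambda>N. phi (arccos (u N)) / u N) \<longlonglongrightarrow> - D"
    by (rule filterlim_compose)
  then have "Bseq (\<lambda>N. phi (arccos (u N)) / u N)"
    by (intro convergent_imp_Bseq convergentI)
  then obtain K where K: "\<bar>phi (arccos (u N)) / u N\<bar> \<le> K" for N
    by (auto simp: Bseq_def)
  have "harm N \<le> 2 * normalizer * (K + 64 / normalizer)" for N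
  proof -
    have "harm (N + 1) / (2 * normalizer) - 64 / normalizer \<le> K"
      using phi_quotient_lower_bound[of N, folded u_def] K[of N] by linarith
    then have "harm (N + 1) / (2 * normalizer) \<le> K + 64 / normalizer" by linarith
    then have "harm (N + 1) \<le> (K + 64 / normalizer) * (2 * normalizer)"
      using normalizer_pos by (subst (asm) pos_divide_le_eq) simp_all
    then have "harm (N + 1) \<le> 2 * normalizer * (K + 64 / normalizer)" by (simp only: mult_ac)
    moreover have "harm N \<le> (harm (N + 1) :: real)" by (rule harm_mono) simp
    ultimately show ?thesis by linarith
  qed
  then have "Bseq (harm :: nat \<Rightarrow> real)"
    using harm_nonneg by (intro BseqI'[of _ "2 * normalizer * (K + 64 / normalizer)"]) auto
  moreover have "incseq (harm :: nat \<Rightarrow> real)"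
    by (auto simp: incseq_def intro: harm_mono)
  ultimately have "convergent (harm :: nat \<Rightarrow> real)"
    by (intro Bseq_mono_convergent) (auto simp: incseq_def)
  then show False using not_convergent_harm by blast
qed

end
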